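(* Let $X$ be an infinite dimensional separable real Hilbert space with orthonormal basis $\{u^{(k)}\}_{k\in\mathbb{N}}$, let $Y$ be an infinite dimensional real Banach space, let $\widetilde A\colon X\to Y$ be an injective bounded linear operator, and let $A\colon \ell^1\to Y$ be given by $Ax=\widetilde A\bigl(\sum_{k=1}^\infty x_k u^{(k)}\bigr)$. Let $x^\dagger\in\ell^1$ and $y=Ax^\dagger$. Assume that there exist elements $f^{(k)}\in Y^*$, $k\in\mathbb{N}$, such that $e^{(k)}=A^*f^{(k)}$ for all $k\in\mathbb{N}$. Define, for $t>0$, $$\varphi_2(t)=2\inf_{n\in\mathbb{N}}\left(\sum_{k=n+1}^\infty |x^\dagger_k|+t\sup_{\substack{a_k\in\{-1,0,1\}\\k=1,\ldots,n}}\left\Vert\sum_{k=1}^n a_k f^{(k)}\right\Vert_{Y^*}\right).$$ Then $\varphi_2$ is a concave index function and the variational inequality $$\|x-x^\dagger\|_{\ell^1}\le \|x\|_{\ell^1}-\|x^\dagger\|_{\ell^1}+\varphi_2(\|Ax-Ax^\dagger\|_Y)\qquad\text{for all } x\in\ell^1$$ holds (with $\varphi_2(0):=0$). Consequently, let $1<p<\infty$ and $1<\tau_1\le\tau_2<\infty$ be fixed, and for noise levels $\delta>0$ and data $y^\delta\in Y$ with $\|y^\delta-y\|_Y\le\delta$ let $x_\alpha^\delta$ be a minimizer over $x\in\ell^1$ of $$\frac1p\|Ax-y^\delta\|_Y^p+\alpha\|x\|_{\ell^1},$$ where the regularization parameter $\alpha=\alpha(\delta,y^\delta)>0$ is chosen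 according to the discrepancy principle $$\tau_1\delta\le\|Ax^\delta_{\alpha(\delta,y^\delta)}-y^\delta\|_Y\le\tau_2\delta.$$ Then $$\|x_\alpha^\delta-x^\dagger\|_{\ell^1}=O(\varphi_2(\delta))\qquad\text{as }\delta\to0.$$
   Context: $\mathbb{N}=\{1,2,\dots\}$. Sequence spaces consist of real sequences. $e^{(k)}=(0,\ldots,0,1,0,\ldots)$ is the $k$-th unit sequence, here regarded as an element of $\ell^\infty=(\ell^1)^*$; $A^*\colon Y^*\to\ell^\infty$ is the Banach space adjoint of $A$. An index function is a continuous, strictly increasing function $\varphi\colon(0,\infty)\to(0,\infty)$ with $\lim_{t\to+0}\varphi(t)=0$. The constant in the $O$-statement may depend on $x^\dagger$ but not on $\delta$ (nor on $y^\delta$). *)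

theory Defs
  imports "HOL-Analysis.Analysis"
begin

text \<open>
  All sequences are indexed from \<open>0\<close>: index \<open>k :: nat\<close> here is index \<open>k + 1\<close> of the mathematical text.
  In particular \<open>{..<n}\<close> stands for the indices \<open>1, \<dots>, n\<close>.
\<close>

section \<open>The space of absolutely summable real sequences\<close>

typedef ell1 = "{x :: nat \<Rightarrow> real. summable (\<lambda>k. \<bar>x k\<bar>)}"
  morphisms seq Ell1
  by (rule exI[of _ "\<lambda>_. 0"]) simp

setup_lifting type_definition_ell1

lemma summable_abs_seq: "summable (\<lambda>k. \<bar>seq x k\<bar>)"
  using seq[of x] by simp

lemma ell1_eqI: "(\<And>k. seq x k = seq y k) \<Longrightarrow> x = y"
  by (metis ext seq_inject)

instantiation ell1 :: real_normed_vector
begin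

lift_definition zero_ell1 :: ell1 is "\<lambda>_. 0"
  by simp

lift_definition plus_ell1 :: "ell1 \<Rightarrow> ell1 \<Rightarrow> ell1" is "\<lambda>x y k. x k + y k"
proof -
  fix x y :: "nat \<Rightarrow> real"
  assume "summable (\<lambda>k. \<bar>x k\<bar>)" "summable (\<lambda>k. \<bar>y k\<bar>)"
  then have "summable (\<lambda>k. \<bar>x k\<bar> + \<bar>y k\<bar>)"
    by (rule summable_add)
  then show "summable (\<lambda>k. \<bar>x k + y k\<bar>)"
    by (rule summable_comparison_test'[where N = 0]) simp
qed

lift_definition minus_ell1 :: "ell1 \<Rightarrow> ell1 \<Rightarrow> ell1" is "\<lambda>x y k. x k - y k"
proof -
  fix x y :: "nat \<Rightarrow> real"
  assume "summable (\<lambda>k. \<bar>x k\<bar>)" "summable (\<lambda>k. \<bar>y k\<bar>)"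
  then have "summable (\<lambda>k. \<bar>x k\<bar> + \<bar>y k\<bar>)"
    by (rule summable_add)
  then show "summable (\<lambda>k. \<bar>x k - y k\<bar>)"
    by (rule summable_comparison_test'[where N = 0]) simp
qed

lift_definition uminus_ell1 :: "ell1 \<Rightarrow> ell1" is "\<lambda>x k. - x k"
  by simp

lift_definition scaleR_ell1 :: "real \<Rightarrow> ell1 \<Rightarrow> ell1" is "\<lambda>c x k. c * x k"
  by (simp add: abs_mult summable_mult)

lift_definition norm_ell1 :: "ell1 \<Rightarrow> real" is "\<lambda>x. \<Sum>k. \<bar>x k\<bar>" .

definition dist_ell1 :: "ell1 \<Rightarrow> ell1 \<Rightarrow> real"
  where "dist_ell1 x y = norm (x - y)"

definition sgn_ell1 :: "ell1 \<Rightarrow> ell1"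
  where "sgn_ell1 x = inverse (norm x) *\<^sub>R x"

definition uniformity_ell1 :: "(ell1 \<times> ell1) filter"
  where "uniformity_ell1 = (INF e\<in>{0 <..}. principal {(x, y). dist x y < e})"

definition open_ell1 :: "ell1 set \<Rightarrow> bool"
  where "open_ell1 S = (\<forall>x\<in>S. \<forall>\<^sub>F (x', y) in uniformity. x' = x \<longrightarrow> y \<in> S)"

instance
proof
  fix x y :: ell1 and c :: real
  show "norm x = 0 \<longleftrightarrow> x = 0"
  proof
    assume "norm x = 0"
    then have "(\<Sum>k. \<bar>seq x k\<bar>) = 0"
      by (simp add: norm_ell1.rep_eq)
    then have "\<bar>seq x k\<bar> = 0" for k
      using suminf_eq_zero_iff[OF summable_abs_seq[of x]] by simp
    then show "x = 0"
      by (intro ell1_eqI) (simp add: zero_ell1.rep_eq)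
  qed (simp add: norm_ell1.rep_eq zero_ell1.rep_eq)
  have s: "summable (\<lambda>k. \<bar>seq x k\<bar> + \<bar>seq y k\<bar>)"
    by (intro summable_add summable_abs_seq)
  have "(\<Sum>k. \<bar>seq (x + y) k\<bar>) \<le> (\<Sum>k. \<bar>seq x k\<bar> + \<bar>seq y k\<bar>)"
    by (intro suminf_le summable_abs_seq s) (simp add: plus_ell1.rep_eq abs_triangle_ineq)
  also have "\<dots> = (\<Sum>k. \<bar>seq x k\<bar>) + (\<Sum>k. \<bar>seq y k\<bar>)"
    by (intro suminf_add[symmetric] summable_abs_seq)
  finally show "norm (x + y) \<le> norm x + norm y"
    by (simp add: norm_ell1.rep_eq)
  show "norm (c *\<^sub>R x) = \<bar>c\<bar> * norm x"
    by (simp add: norm_ell1.rep_eq scaleR_ell1.rep_eq abs_mult suminf_mult summable_abs_seq)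
qed (simp_all add: dist_ell1_def sgn_ell1_def uniformity_ell1_def open_ell1_def,
     (transfer, simp add: algebra_simps fun_eq_iff)+)

end

section \<open>Adjoints and the duality between the spaces of summable and of bounded sequences\<close>

definition linfty_unit :: "nat \<Rightarrow> (nat \<Rightarrow>\<^sub>C real)"
  where "linfty_unit k = Bcontfun (\<lambda>j. if j = k then 1 else 0)"

lemma apply_linfty_unit: "apply_bcontfun (linfty_unit k) j = (if j = k then 1 else 0)"
proof -
  have "(\<lambda>j. if j = k then 1 else 0 :: real) \<in> bcontfun"
    by (auto simp: bcontfun_def intro!: boundedI[where B = 1])
  then show ?thesis
    by (simp add: linfty_unit_def Bcontfun_inverse)
qed

text \<open>
  Since \<open>nat\<close> carries the discrete topology, \<open>nat \<Rightarrow>\<^sub>C real\<close> is the space of bounded sequences.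
  The next function is its identification with the dual of \<open>ell1\<close>.
\<close>

lift_definition linfty_functional :: "(nat \<Rightarrow>\<^sub>C real) \<Rightarrow> (ell1 \<Rightarrow>\<^sub>L real)"
  is "\<lambda>\<xi> x. \<Sum>k. apply_bcontfun \<xi> k * seq x k"
proof -
  fix \<xi> :: "nat \<Rightarrow>\<^sub>C real"
  have le: "\<bar>apply_bcontfun \<xi> k * seq x k\<bar> \<le> norm \<xi> * \<bar>seq x k\<bar>" for x k
    using norm_bounded[of \<xi> k] by (simp add: abs_mult mult_right_mono)
  have sm: "summable (\<lambda>k. norm \<xi> * \<bar>seq x k\<bar>)" for x
    by (intro summable_mult summable_abs_seq)
  have sa: "summable (\<lambda>k. \<bar>apply_bcontfun \<xi> k * seq x k\<bar>)" for x
    by (rule summable_comparison_test'[OF sm[of x], where N = 0]) (use le in simp)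
  have s: "summable (\<lambda>k. apply_bcontfun \<xi> k * seq x k)" for x
    using sa by (rule summable_rabs_cancel)
  show "bounded_linear (\<lambda>x. \<Sum>k. apply_bcontfun \<xi> k * seq x k)"
  proof (rule bounded_linear_intro[where K = "norm \<xi>"])
    fix x y :: ell1 and c :: real
    show "(\<Sum>k. apply_bcontfun \<xi> k * seq (x + y) k)
        = (\<Sum>k. apply_bcontfun \<xi> k * seq x k) + (\<Sum>k. apply_bcontfun \<xi> k * seq y k)"
      by (simp add: suminf_add[OF s s] plus_ell1.rep_eq distrib_left)
    show "(\<Sum>k. apply_bcontfun \<xi> k * seq (c *\<^sub>R x) k)
        = c *\<^sub>R (\<Sum>k. apply_bcontfun \<xi> k * seq x k)"
      by (simp add: suminf_mult[OF s, symmetric] scaleR_ell1.rep_eq mult.left_commute)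
    have "\<bar>\<Sum>k. apply_bcontfun \<xi> k * seq x k\<bar> \<le> (\<Sum>k. \<bar>apply_bcontfun \<xi> k * seq x k\<bar>)"
      by (rule summable_rabs[OF sa])
    also have "\<dots> \<le> (\<Sum>k. norm \<xi> * \<bar>seq x k\<bar>)"
      by (rule suminf_le[OF le sa sm])
    also have "\<dots> = norm x * norm \<xi>"
      by (simp add: suminf_mult[OF summable_abs_seq] norm_ell1.rep_eq mult.commute)
    finally show "norm (\<Sum>k. apply_bcontfun \<xi> k * seq x k) \<le> norm x * norm \<xi>"
      by simp
  qed
qed

definition banach_adjoint ::
    "('a::real_normed_vector \<Rightarrow>\<^sub>L 'b::real_normed_vector) \<Rightarrow> ('b \<Rightarrow>\<^sub>L real) \<Rightarrow> ('a \<Rightarrow>\<^sub>L real)"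
  where "banach_adjoint A f = f o\<^sub>L A"

section \<open>Bases and synthesis operators\<close>

definition infinite_dimensional :: "'a::real_vector set \<Rightarrow> bool"
  where "infinite_dimensional S \<longleftrightarrow> (\<nexists>B. finite B \<and> S \<subseteq> span B)"

definition orthonormal_basis :: "(nat \<Rightarrow> 'a::real_inner) \<Rightarrow> bool"
  where "orthonormal_basis u \<longleftrightarrow>
    (\<forall>j k. u j \<bullet> u k = (if j = k then 1 else 0)) \<and> closure (span (range u)) = UNIV"

text \<open>
  For an orthonormal basis, the prescription \<open>x \<mapsto> T (\<Sum>k. x\<^sub>k u\<^sub>k)\<close> always defines a bounded operator
  on \<open>ell1\<close>, so an operator given by this formula may be taken of type \<open>\<Rightarrow>\<^sub>L\<close>.
\<close>

lemma bounded_linear_synthesis: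
  fixes u :: "nat \<Rightarrow> 'a::{real_inner, complete_space}" and T :: "'a \<Rightarrow>\<^sub>L 'b::real_normed_vector"
  assumes "orthonormal_basis u"
  shows "bounded_linear (\<lambda>x. T (\<Sum>k. seq x k *\<^sub>R u k))"
proof -
  have nu: "norm (u k) = 1" for k
    using assms by (simp add: orthonormal_basis_def norm_eq_sqrt_inner)
  have "Cauchy (\<lambda>n. \<Sum>k<n. seq x k *\<^sub>R u k)" for x
  proof (rule metric_CauchyI)
    fix e :: real assume "e > 0"
    then obtain N where N: "\<And>m n. m \<ge> N \<Longrightarrow> norm (\<Sum>k=m..<n. \<bar>seq x k\<bar>) < e"
      using summable_abs_seq[of x] unfolding summable_Cauchy by blast
    have ord: "norm ((\<Sum>k<n. seq x k *\<^sub>R u k) - (\<Sum>k<m. seq x k *\<^sub>R u k)) < e"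
      if "m \<ge> N" "m \<le> n" for m n
    proof -
      have "(\<Sum>k<n. seq x k *\<^sub>R u k) - (\<Sum>k<m. seq x k *\<^sub>R u k) = (\<Sum>k=m..<n. seq x k *\<^sub>R u k)"
        using sum_diff_nat_ivl[of 0 m n "\<lambda>k. seq x k *\<^sub>R u k"] that by (simp add: lessThan_atLeast0)
      also have "norm \<dots> \<le> (\<Sum>k=m..<n. \<bar>seq x k\<bar>)"
        by (rule sum_norm_le) (simp add: nu)
      also have "\<dots> < e"
        using N[OF that(1), of n] by simp
      finally show ?thesis .
    qed
    show "\<exists>M. \<forall>m\<ge>M. \<forall>n\<ge>M. dist (\<Sum>k<m. seq x k *\<^sub>R u k) (\<Sum>k<n. seq x k *\<^sub>R u k) < e"
      by (metis dist_norm dist_commute nle_le ord)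
  qed
  then have s: "summable (\<lambda>k. seq x k *\<^sub>R u k)" for x
    by (simp add: summable_iff_convergent Cauchy_convergent_iff)
  have "bounded_linear (\<lambda>x. \<Sum>k. seq x k *\<^sub>R u k)"
  proof (rule bounded_linear_intro[where K = 1])
    fix x y :: ell1 and c :: real
    show "(\<Sum>k. seq (x + y) k *\<^sub>R u k) = (\<Sum>k. seq x k *\<^sub>R u k) + (\<Sum>k. seq y k *\<^sub>R u k)"
      by (simp add: suminf_add[OF s s] plus_ell1.rep_eq scaleR_left_distrib)
    show "(\<Sum>k. seq (c *\<^sub>R x) k *\<^sub>R u k) = c *\<^sub>R (\<Sum>k. seq x k *\<^sub>R u k)"
      by (simp add: suminf_scaleR_right[OF s] scaleR_ell1.rep_eq)
    have "(\<lambda>n. norm (\<Sum>k<n. seq x k *\<^sub>R u k)) \<longlonglongrightarrow> norm (\<Sum>k. seq x k *\<^sub>R u k)"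
      by (intro tendsto_norm summable_LIMSEQ s)
    moreover have "norm (\<Sum>k<n. seq x k *\<^sub>R u k) \<le> (\<Sum>k. \<bar>seq x k\<bar>)" for n
    proof -
      have "norm (\<Sum>k<n. seq x k *\<^sub>R u k) \<le> (\<Sum>k<n. \<bar>seq x k\<bar>)"
        by (rule sum_norm_le) (simp add: nu)
      also have "\<dots> \<le> (\<Sum>k. \<bar>seq x k\<bar>)"
        by (rule sum_le_suminf[OF summable_abs_seq]) auto
      finally show ?thesis .
    qed
    ultimately show "norm (\<Sum>k. seq x k *\<^sub>R u k) \<le> norm x * 1"
      by (simp add: norm_ell1.rep_eq LIMSEQ_le_const2)
  qed
  then show ?thesis
    by (rule bounded_linear_compose[OF blinfun.bounded_linear_right])
qed

section \<open>Index functions, the rate function and Tikhonov regularization\<close>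

definition index_function :: "(real \<Rightarrow> real) \<Rightarrow> bool"
  where "index_function \<phi> \<longleftrightarrow>
    continuous_on {0<..} \<phi> \<and> strict_mono_on {0<..} \<phi> \<and> (\<forall>t>0. \<phi> t > 0) \<and>
    (\<phi> \<longlongrightarrow> 0) (at_right 0)"

text \<open>The infimum is over \<open>n \<ge> 1\<close>; the value at \<open>t = 0\<close> is \<open>0\<close> by convention.\<close>

definition phi2 :: "(nat \<Rightarrow> 'b::real_normed_vector \<Rightarrow>\<^sub>L real) \<Rightarrow> ell1 \<Rightarrow> real \<Rightarrow> real"
  where "phi2 f xd t =
    (if t > 0 then
       2 * (INF n\<in>{1..}. (\<Sum>k. \<bar>seq xd (k + n)\<bar>) +
              t * (SUP a\<in>{..<n} \<rightarrow>\<^sub>E {-1, 0, 1}. norm (\<Sum>k<n. a k *\<^sub>R f k)))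
     else 0)"

definition tikhonov_functional ::
    "real \<Rightarrow> (ell1 \<Rightarrow>\<^sub>L 'b::real_normed_vector) \<Rightarrow> 'b \<Rightarrow> real \<Rightarrow> ell1 \<Rightarrow> real"
  where "tikhonov_functional p A yd \<alpha> x = 1 / p * norm (A x - yd) powr p + \<alpha> * norm x"

end

theory Submission
  imports Defs
begin

text \<open>
  Applying \<open>f k\<close> to \<open>A (x - xdag)\<close> recovers the coordinate \<open>x k - xdag k\<close>, so the first \<open>n\<close> terms of
  \<open>norm (x - xdag)\<close> are a sign combination of the functionals \<open>f k\<close> evaluated at \<open>A (x - xdag)\<close>, while
  the remaining ones cost at most twice the tail of \<open>xdag\<close>; taking the infimum over \<open>n\<close> gives the
  variational inequality. As an infimum of affine functions whose slopes are bounded below by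
  \<open>norm (f 0) > 0\<close>, the rate function is concave and strictly increasing, and it satisfies
  \<open>phi2 (c * t) \<le> c * phi2 t\<close> for \<open>c \<ge> 1\<close>. The discrepancy principle forces
  \<open>norm x \<le> norm xdag\<close> for the minimizer, and the rate follows.
\<close>

section \<open>Tails of summable sequences and norms of sign combinations\<close>

definition seq_tail :: "ell1 \<Rightarrow> nat \<Rightarrow> real"
  where "seq_tail x n = (\<Sum>k. \<bar>seq x (k + n)\<bar>)"

definition sign_norm :: "(nat \<Rightarrow> 'a::real_normed_vector) \<Rightarrow> nat \<Rightarrow> real"
  where "sign_norm f n = (SUP a\<in>{..<n} \<rightarrow>\<^sub>E {-1, 0, 1}. norm (\<Sum>k<n. a k *\<^sub>R f k))"

lemma seq_tail_nonneg: "0 \<le> seq_tail x n"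
  unfolding seq_tail_def
  by (intro suminf_nonneg summable_ignore_initial_segment summable_abs_seq) auto

lemma seq_tail_split: "norm x = seq_tail x n + (\<Sum>k<n. \<bar>seq x k\<bar>)"
  unfolding seq_tail_def norm_ell1.rep_eq
  by (rule suminf_split_initial_segment[OF summable_abs_seq])

lemma seq_tail_tendsto_0: "seq_tail x \<longlonglongrightarrow> 0"
proof (rule LIMSEQ_I)
  fix r :: real assume "0 < r"
  from suminf_exist_split[OF this summable_abs_seq[of x]]
  show "\<exists>N. \<forall>n\<ge>N. norm (seq_tail x n - 0) < r"
    by (simp add: seq_tail_def)
qed

lemma norm_sum_le_sign_norm:
  assumes "\<And>k. k < n \<Longrightarrow> a k \<in> {-1, 0, 1}"
  shows "norm (\<Sum>k<n. a k *\<^sub>R f k) \<le> sign_norm f n"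
proof -
  \<comment> \<open>Members of the extensional function space are \<open>undefined\<close> off
    \<open>{..<n}\<close>, so \<open>a\<close> is cut down before it competes in the
    supremum.\<close>
  let ?a = "restrict a {..<n}"
  have fin: "finite ({..<n} \<rightarrow>\<^sub>E {-1, 0, 1 :: real})"
    by (intro finite_PiE) auto
  have "?a \<in> {..<n} \<rightarrow>\<^sub>E {-1, 0, 1}"
    using assms by (intro restrict_PiE_iff[THEN iffD2]) auto
  then have "norm (\<Sum>k<n. ?a k *\<^sub>R f k) \<le> sign_norm f n"
    unfolding sign_norm_def
    by (intro cSUP_upper bdd_above_finite finite_imageI fin)
  moreover have "(\<Sum>k<n. ?a k *\<^sub>R f k) = (\<Sum>k<n. a k *\<^sub>R f k)"
    by (intro sum.cong) auto
  ultimately show ?thesis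
    by simp
qed

text \<open>The single-spike sign pattern is admissible. With \<open>j = 0\<close> it bounds all
  slopes with \<open>n \<ge> 1\<close> from below, uniformly in \<open>n\<close>.\<close>

lemma norm_le_sign_norm:
  assumes "j < n"
  shows "norm (f j) \<le> sign_norm f n"
proof -
  have "(\<Sum>k<n. (if k = j then 1 else 0) *\<^sub>R f k) = f j"
    using assms by (simp add: if_distrib[of "\<lambda>c. c *\<^sub>R _"] cong: if_cong)
  then show ?thesis
    using norm_sum_le_sign_norm[of n "\<lambda>k. if k = j then 1 else 0" f] by simp
qed

lemma sign_norm_nonneg: "0 \<le> sign_norm f n"
  using norm_sum_le_sign_norm[of n "\<lambda>_. 0" f] by simp

section \<open>The rate function as an infimum of affine functions\<close>

lemma phi2_le:
  assumes "0 < t" "1 \<le> n"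
  shows "phi2 f x t \<le> 2 * (seq_tail x n + t * sign_norm f n)"
proof -
  have "bdd_below ((\<lambda>n. seq_tail x n + t * sign_norm f n) ` {1..})"
    using assms(1)
    by (intro bdd_belowI2[where m = 0] add_nonneg_nonneg mult_nonneg_nonneg
        seq_tail_nonneg sign_norm_nonneg) auto
  from cINF_lower[OF this, of n] show ?thesis
    using assms by (simp add: phi2_def seq_tail_def sign_norm_def)
qed

text \<open>Together with \<open>phi2_le\<close> this is all that the later lemmas use about the
  infimum for positive arguments.\<close>

lemma phi2_ge:
  assumes "0 < t" and "\<And>n. 1 \<le> n \<Longrightarrow> c \<le> 2 * (seq_tail x n + t * sign_norm f n)"
  shows "c \<le> phi2 f x t"
proof -
  have "c / 2 \<le> (INF n\<in>{1..}. seq_tail x n + t * sign_norm f n)"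
    using assms(2) by (intro cINF_greatest) (auto simp: field_simps)
  then show ?thesis
    using assms(1) by (simp add: phi2_def seq_tail_def sign_norm_def)
qed

text \<open>Each affine competitor has slope at least \<open>2 * norm (f 0)\<close>, and this growth
  survives the infimum. Excluding \<open>n = 0\<close> matters: that competitor would be
  constant.\<close>

lemma phi2_increment:
  assumes "0 < t" "t \<le> s"
  shows "phi2 f x t + 2 * (s - t) * norm (f 0) \<le> phi2 f x s"
proof (rule phi2_ge)
  show "0 < s" using assms by simp
next
  fix n :: nat assume n: "1 \<le> n"
  have "(s - t) * norm (f 0) \<le> (s - t) * sign_norm f n"
    using n assms by (intro mult_left_mono norm_le_sign_norm) auto
  with phi2_le[OF assms(1) n, of f x]
  show "phi2 f x t + 2 * (s - t) * norm (f 0) \<le> 2 * (seq_tail x n + s * sign_norm f n)"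
    by (simp add: algebra_simps)
qed

lemma phi2_ge_linear:
  assumes "0 < t"
  shows "2 * t * norm (f 0) \<le> phi2 f x t"
proof (rule phi2_ge[OF assms])
  fix n :: nat assume "1 \<le> n"
  then have "t * norm (f 0) \<le> t * sign_norm f n"
    using assms by (intro mult_left_mono norm_le_sign_norm) auto
  then show "2 * t * norm (f 0) \<le> 2 * (seq_tail x n + t * sign_norm f n)"
    using seq_tail_nonneg[of x n] by simp
qed

lemma phi2_nonneg: "0 \<le> phi2 f x t"
proof (cases "0 < t")
  case True
  then have "0 \<le> 2 * t * norm (f 0)"
    by simp
  then show ?thesis
    using phi2_ge_linear[OF True, of f x] by linarith
qed (simp add: phi2_def)

lemma phi2_mono:
  assumes "t \<le> s"
  shows "phi2 f x t \<le> phi2 f x s"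
proof (cases "0 < t")
  case True
  have "0 \<le> 2 * (s - t) * norm (f 0)"
    using assms by simp
  then show ?thesis
    using phi2_increment[OF True assms, of f x] by linarith
next
  case False
  then show ?thesis
    using phi2_nonneg[of f x s] by (simp add: phi2_def)
qed

lemma phi2_scale:
  assumes "0 < t" "1 \<le> c"
  shows "phi2 f x (c * t) \<le> c * phi2 f x t"
proof -
  have "phi2 f x (c * t) / c \<le> phi2 f x t"
  proof (rule phi2_ge[OF assms(1)])
    fix n :: nat assume n: "1 \<le> n"
    have "phi2 f x (c * t) \<le> 2 * (seq_tail x n + (c * t) * sign_norm f n)"
      using assms n by (intro phi2_le) auto
    \<comment> \<open>Only the slope term scales with \<open>c\<close>; enlarging the tail as well
      makes \<open>c\<close> a common factor.\<close>
    also have "\<dots> \<le> 2 * (c * seq_tail x n + (c * t) * sign_norm f n)"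
      using mult_right_mono[OF assms(2) seq_tail_nonneg[of x n]] by simp
    finally show "phi2 f x (c * t) / c \<le> 2 * (seq_tail x n + t * sign_norm f n)"
      using assms by (simp add: divide_le_eq algebra_simps)
  qed
  then show ?thesis
    using assms by (simp add: divide_le_eq mult.commute)
qed

lemma concave_on_phi2: "concave_on {0<..} (phi2 f x)"
  unfolding concave_on_iff
proof (intro conjI ballI allI impI)
  fix s t u v :: real
  assume st: "s \<in> {0<..}" "t \<in> {0<..}" and uv: "0 \<le> u" "0 \<le> v" "u + v = 1"
  have pos: "0 < u * s + v * t"
    using st uv convex_real_interval(3)[of 0] unfolding convex_def by fastforce
  have "u * phi2 f x s + v * phi2 f x t \<le> phi2 f x (u * s + v * t)"
  proof (rule phi2_ge[OF pos])
    fix n :: nat assume n: "1 \<le> n"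
    have "u * phi2 f x s + v * phi2 f x t
        \<le> u * (2 * (seq_tail x n + s * sign_norm f n)) + v * (2 * (seq_tail x n + t * sign_norm f n))"
      using st uv n by (intro add_mono mult_left_mono phi2_le) auto
    also have "\<dots> = 2 * ((u + v) * seq_tail x n + (u * s + v * t) * sign_norm f n)"
      by (simp add: algebra_simps)
    finally show "u * phi2 f x s + v * phi2 f x t
        \<le> 2 * (seq_tail x n + (u * s + v * t) * sign_norm f n)"
      using uv by simp
  qed
  then show "u * phi2 f x s + v * phi2 f x t \<le> phi2 f x (u *\<^sub>R s + v *\<^sub>R t)"
    by simp
qed simp

text \<open>First \<open>n\<close> is fixed so that the tail is small; then \<open>t\<close> tends
  to zero while the slope for this \<open>n\<close> stays fixed.\<close>

lemma tendsto_phi2: "(phi2 f x \<longlongrightarrow> 0) (at_right 0)"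
proof (rule order_tendstoI)
  fix a :: real assume "a < 0"
  then show "\<forall>\<^sub>F t in at_right 0. a < phi2 f x t"
    using phi2_nonneg[of f x] by (intro always_eventually) (auto intro: less_le_trans)
next
  fix e :: real assume "0 < e"
  then have "\<forall>\<^sub>F n in sequentially. seq_tail x n < e / 2"
    by (intro order_tendstoD(2)[OF seq_tail_tendsto_0]) auto
  then have "\<forall>\<^sub>F n in sequentially. 1 \<le> n \<and> seq_tail x n < e / 2"
    by (intro eventually_conj eventually_ge_at_top)
  then obtain n where n: "1 \<le> n" "seq_tail x n < e / 2"
    by (auto dest: eventually_happens)
  have "((\<lambda>t. 2 * (seq_tail x n + t * sign_norm f n)) \<longlongrightarrow> 2 * (seq_tail x n + 0 * sign_norm f n))
      (at_right 0)"
    by (intro tendsto_intros)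
  then have "\<forall>\<^sub>F t in at_right 0. 2 * (seq_tail x n + t * sign_norm f n) < e"
    by (rule order_tendstoD(2)) (use n(2) in simp)
  then show "\<forall>\<^sub>F t in at_right 0. phi2 f x t < e"
    using eventually_at_right_less[of 0]
    by eventually_elim (use phi2_le n(1) in \<open>blast intro: le_less_trans\<close>)
qed

lemma index_function_phi2:
  assumes "f 0 \<noteq> 0"
  shows "index_function (phi2 f x)"
  unfolding index_function_def
proof (intro conjI allI impI)
  show "continuous_on {0<..} (phi2 f x)"
    \<comment> \<open>Continuity comes from concavity: a convex function on an open interval is
      continuous, applied to the negated rate function.\<close>
    using convex_on_continuous[OF open_greaterThan, of 0 "\<lambda>t. - phi2 f x t"]
      continuous_on_minus[of "{0<..}" "\<lambda>t. - phi2 f x t"]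
      concave_on_phi2[of f x] by (simp add: concave_on_def)
  show "strict_mono_on {0<..} (phi2 f x)"
  proof (rule strict_mono_onI)
    fix r s :: real assume "r \<in> {0<..}" "s \<in> {0<..}" "r < s"
    then have "0 < 2 * (s - r) * norm (f 0)" "phi2 f x r + 2 * (s - r) * norm (f 0) \<le> phi2 f x s"
      using assms by (simp, intro phi2_increment) auto
    then show "phi2 f x r < phi2 f x s"
      by linarith
  qed
  fix t :: real assume t: "0 < t"
  then have "0 < 2 * t * norm (f 0)"
    using assms by simp
  then show "0 < phi2 f x t"
    using phi2_ge_linear[OF t, of f x] by linarith
qed (rule tendsto_phi2)

section \<open>Coordinate recovery and the variational inequality\<close>

lemma linfty_functional_unit: "linfty_functional (linfty_unit k) x = seq x k"
proof -
  have "linfty_functional (linfty_unit k) x = (\<Sum>j. if j = k then seq x j else 0)"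
    by (auto simp: linfty_functional.rep_eq apply_linfty_unit intro!: suminf_cong)
  also have "\<dots> = seq x k"
    using sums_single[of k "seq x"] by (simp add: sums_iff)
  finally show ?thesis .
qed

text \<open>All three norms are split at \<open>n\<close>. The triangle inequality, on the tails for
  \<open>z = x - xd\<close> and on the heads for \<open>xd = x - z\<close>, cancels the
  contributions of \<open>x\<close> and leaves twice the tail of \<open>xd\<close> plus twice the
  head of \<open>z\<close>.\<close>

lemma variational_inequality:
  fixes A :: "ell1 \<Rightarrow>\<^sub>L 'y::real_normed_vector" and f :: "nat \<Rightarrow> 'y \<Rightarrow>\<^sub>L real"
  assumes "\<And>k z. f k (A z) = seq z k"
  shows "norm (x - xd) \<le> norm x - norm xd + phi2 f xd (norm (A x - A xd))"
proof (cases "A x = A xd")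
  \<comment> \<open>Here the rate term is \<open>0\<close> by convention, so the claim needs
    injectivity of \<open>A\<close>, which coordinate recovery provides.\<close>
  case True
  then have "x = xd"
    by (metis assms ell1_eqI)
  then show ?thesis
    by (simp add: phi2_def)
next
  case False
  define z where "z = x - xd"
  have Az: "A z = A x - A xd"
    by (simp add: z_def blinfun.diff_right)
  have seq_z: "seq z k = seq x k - seq xd k" for k
    by (simp add: z_def minus_ell1.rep_eq)
  have "norm z - norm x + norm xd \<le> phi2 f xd (norm (A z))"
  proof (rule phi2_ge)
    show "0 < norm (A z)"
      using False Az by simp
  next
    fix n :: nat assume "1 \<le> n"
    \<comment> \<open>The signs of \<open>z\<close> turn the head of its norm into one functional
      evaluated at \<open>A z\<close>.\<close>
    let ?g = "\<Sum>k<n. sgn (seq z k) *\<^sub>R f k"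
    have "(\<Sum>k<n. \<bar>seq z k\<bar>) = ?g (A z)"
      by (simp add: blinfun.sum_left blinfun.scaleR_left assms abs_sgn mult.commute)
    also have "\<dots> \<le> norm ?g * norm (A z)"
      using norm_blinfun[of ?g "A z"] by simp
    also have "\<dots> \<le> sign_norm f n * norm (A z)"
      by (intro mult_right_mono norm_sum_le_sign_norm) (auto simp: sgn_real_def)
    finally have initial: "(\<Sum>k<n. \<bar>seq z k\<bar>) \<le> norm (A z) * sign_norm f n"
      by (simp add: mult.commute)
    have "(\<Sum>k<n. \<bar>seq xd k\<bar>) \<le> (\<Sum>k<n. \<bar>seq z k\<bar> + \<bar>seq x k\<bar>)"
      by (intro sum_mono) (simp add: seq_z)
    moreover have "seq_tail z n \<le> seq_tail x n + seq_tail xd n"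
    proof -
      note s = summable_ignore_initial_segment[OF summable_abs_seq, of _ n]
      have "seq_tail z n \<le> (\<Sum>k. \<bar>seq x (k + n)\<bar> + \<bar>seq xd (k + n)\<bar>)"
        unfolding seq_tail_def by (intro suminf_le s summable_add) (simp add: seq_z)
      then show ?thesis
        by (simp add: seq_tail_def suminf_add[OF s s])
    qed
    ultimately show "norm z - norm x + norm xd
        \<le> 2 * (seq_tail xd n + norm (A z) * sign_norm f n)"
      using initial
      by (simp add: seq_tail_split[of z n] seq_tail_split[of x n] seq_tail_split[of xd n]
          sum.distrib)
  qed
  then show ?thesis
    unfolding Az unfolding z_def by simp
qed

section \<open>Rates under the discrepancy principle\<close>

lemma norm_minimizer_le:
  assumes "1 < p" "0 < \<alpha>"
    and "is_arg_min (tikhonov_functional p A ydel \<alpha>) (\<lambda>_. True) x"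
    and "norm (A xd - ydel) \<le> norm (A x - ydel)"
  shows "norm x \<le> norm xd"
proof -
  have "tikhonov_functional p A ydel \<alpha> x \<le> tikhonov_functional p A ydel \<alpha> xd"
    using assms(3) by (simp add: is_arg_min_linorder)
  \<comment> \<open>The competitor \<open>xd\<close> has the smaller fidelity term, so minimality of
    \<open>x\<close> can only be due to its penalty.\<close>
  moreover have "1 / p * norm (A xd - ydel) powr p \<le> 1 / p * norm (A x - ydel) powr p"
    using assms(1,4) by (intro mult_left_mono powr_mono2) auto
  ultimately have "\<alpha> * norm x \<le> \<alpha> * norm xd"
    by (simp add: tikhonov_functional_def)
  then show ?thesis
    using assms(2) by simp
qed

theorem theorem3p3:
  fixes u :: "nat \<Rightarrow> 'x::{real_inner, complete_space}"
    and At :: "'x \<Rightarrow>\<^sub>L 'y::banach"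
    and A :: "ell1 \<Rightarrow>\<^sub>L 'y"
    and xdag :: ell1
    and y :: 'y
    and f :: "nat \<Rightarrow> 'y \<Rightarrow>\<^sub>L real"
  assumes "infinite_dimensional (UNIV :: 'x set)"
    and "separable_space (euclidean :: 'x topology)"
    and "orthonormal_basis u"
    and "infinite_dimensional (UNIV :: 'y set)"
    and "inj (blinfun_apply At)"
    and A: "\<And>x. blinfun_apply A x = blinfun_apply At (\<Sum>k. seq x k *\<^sub>R u k)"
    and "y = blinfun_apply A xdag"
    and "\<And>k. linfty_functional (linfty_unit k) = banach_adjoint A (f k)"
  shows "index_function (phi2 f xdag) \<and>
    concave_on {0<..} (phi2 f xdag) \<and>
    (\<forall>x. norm (x - xdag) \<le> norm x - norm xdag + phi2 f xdag (norm (A x - A xdag))) \<and>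
    (\<forall>p \<tau>1 \<tau>2 :: real. 1 < p \<longrightarrow> 1 < \<tau>1 \<longrightarrow> \<tau>1 \<le> \<tau>2 \<longrightarrow>
      (\<exists>C. \<forall>\<^sub>F \<delta> in at_right 0. \<forall>ydel \<alpha> x.
         norm (ydel - y) \<le> \<delta> \<longrightarrow> \<alpha> > 0 \<longrightarrow>
         is_arg_min (tikhonov_functional p A ydel \<alpha>) (\<lambda>_. True) x \<longrightarrow>
         \<tau>1 * \<delta> \<le> norm (A x - ydel) \<longrightarrow> norm (A x - ydel) \<le> \<tau>2 * \<delta> \<longrightarrow>
         norm (x - xdag) \<le> C * phi2 f xdag \<delta>))"
proof (intro conjI allI impI)
  have coord: "f k (A z) = seq z k" for k z
    using assms(8)[of k] linfty_functional_unit[of k z] by (simp add: banach_adjoint_def)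
  \<comment> \<open>Testing on the image of the first unit sequence shows that \<open>f 0\<close> is
    nonzero.\<close>
  have "f 0 (A (Ell1 (\<lambda>k. if k = 0 then 1 else 0))) = 1"
    unfolding coord by (subst Ell1_inverse) (auto intro!: summable_finite[of "{0}"])
  then have "f 0 \<noteq> 0"
    by auto
  then show "index_function (phi2 f xdag)"
    by (rule index_function_phi2)
  show "concave_on {0<..} (phi2 f xdag)"
    by (rule concave_on_phi2)
  show vi: "norm (x - xdag) \<le> norm x - norm xdag + phi2 f xdag (norm (A x - A xdag))" for x
    using coord by (rule variational_inequality)
  fix p \<tau>1 \<tau>2 :: real
  assume p: "1 < p" and \<tau>: "1 < \<tau>1" "\<tau>1 \<le> \<tau>2"
  \<comment> \<open>In the constant, \<tau>2 comes from the upper discrepancy bound and 1 from the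
    noise.\<close>
  have "norm (x - xdag) \<le> (\<tau>2 + 1) * phi2 f xdag \<delta>"
    if \<delta>: "0 < \<delta>" and noise: "norm (ydel - y) \<le> \<delta>" and \<alpha>: "0 < \<alpha>"
      and min: "is_arg_min (tikhonov_functional p A ydel \<alpha>) (\<lambda>_. True) x"
      and lower: "\<tau>1 * \<delta> \<le> norm (A x - ydel)" and upper: "norm (A x - ydel) \<le> \<tau>2 * \<delta>"
    for \<delta> ydel \<alpha> x
  proof -
    have "norm (A xdag - ydel) \<le> \<delta>"
      using noise assms(7) by (simp add: norm_minus_commute)
    \<comment> \<open>The lower discrepancy bound thus makes the misfit of \<open>x\<close> at least
      that of \<open>xdag\<close>.\<close>
    also have "\<delta> \<le> \<tau>1 * \<delta>"
      using \<delta> \<tau> by simp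
    also note lower
    finally have "norm x \<le> norm xdag"
      by (rule norm_minimizer_le[OF p \<alpha> min])
    then have "norm (x - xdag) \<le> phi2 f xdag (norm (A x - A xdag))"
      using vi[of x] by linarith
    also have "norm (A x - A xdag) \<le> (\<tau>2 + 1) * \<delta>"
      using norm_triangle_ineq[of "A x - ydel" "ydel - y"] noise upper assms(7)
      by (simp add: algebra_simps)
    then have "phi2 f xdag (norm (A x - A xdag)) \<le> phi2 f xdag ((\<tau>2 + 1) * \<delta>)"
      by (rule phi2_mono)
    also have "\<dots> \<le> (\<tau>2 + 1) * phi2 f xdag \<delta>"
      using \<delta> \<tau> by (intro phi2_scale) auto
    finally show ?thesis .
  qed
  then show "\<exists>C. \<forall>\<^sub>F \<delta> in at_right 0. \<forall>ydel \<alpha> x.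
         norm (ydel - y) \<le> \<delta> \<longrightarrow> \<alpha> > 0 \<longrightarrow>
         is_arg_min (tikhonov_functional p A ydel \<alpha>) (\<lambda>_. True) x \<longrightarrow>
         \<tau>1 * \<delta> \<le> norm (A x - ydel) \<longrightarrow> norm (A x - ydel) \<le> \<tau>2 * \<delta> \<longrightarrow>
         norm (x - xdag) \<le> C * phi2 f xdag \<delta>"
    by (intro exI[of _ "\<tau>2 + 1"] eventually_mono[OF eventually_at_right_less[of 0]]) blast
qed

end
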